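(* The calculus $\mathrm{L}+(\mathrm{CS})$ can be embedded in $\mathrm{L}^{\circlearrowleft}$: there are functions $\mathcal{A}$ and $\mathcal{S}$ from the types of $\mathrm{L}+(\mathrm{CS})$ to the types of $\mathrm{L}^{\circlearrowleft}$ such that a sequent $\Pi\to A$ is derivable in $\mathrm{L}+(\mathrm{CS})$ if and only if the sequent $\mathcal{A}(\Pi)\to\mathcal{S}(A)$ is derivable in $\mathrm{L}^{\circlearrowleft}$. Here, for $\Pi=A_1,\dots,A_n$, $\mathcal{A}(\Pi)$ denotes $\mathcal{A}(A_1),\dots,\mathcal{A}(A_n)$.
   Context: Fix a set $Pr$ of primitive types. Types of $\mathrm{L}+(\mathrm{CS})$ are built from primitive types using the binary connectives $\backslash$, $/$, $\cdot$; types of $\mathrm{L}^{\circlearrowleft}$ are built from primitive types using $\backslash$, $/$, $\cdot$ and a unary connective $A\mapsto A^{\circlearrowleft}$. In both calculi a sequent is $A_1,\dots,A_n\to B$ with $n\ge 1$ and $A_i,B$ types. Capital Latin letters denote types, $\Gamma,\Delta$ finite (possibly empty) sequences of types, $\Pi,\Psi$ nonempty finite sequences of types. The axioms and rules of the Lambek calculus $\mathrm{L}$ are: - $(\mathrm{Ax})$: $A\to A$. - $(\backslash\to)$: from $\Gamma,B,\Delta\to C$ and $\Pi\to A$ infer $\Gamma,\Pi,A\backslash B,\Delta\to C$. - $(\to\backslash)$: from $A,\Pi\to B$ infer $\Pi\to A\backslash B$. - $(/\to)$: from $\Gamma,B,\Delta\to C$ and $\Pi\to A$ infer $\Gamma,B/A,\Pi,\Delta\to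 C$. - $(\to/)$: from $\Pi,A\to B$ infer $\Pi\to B/A$. - $(\cdot\to)$: from $\Gamma,A,B,\Delta\to C$ infer $\Gamma,A\cdot B,\Delta\to C$. - $(\to\cdot)$: from $\Pi\to A$ and $\Psi\to B$ infer $\Pi,\Psi\to A\cdot B$. - $(\mathrm{cut})$: from $\Pi\to A$ and $\Gamma,A,\Delta\to B$ infer $\Gamma,\Pi,\Delta\to B$. The calculus $\mathrm{L}+(\mathrm{CS})$ is obtained from $\mathrm{L}$ by adding the structural rule - $(\mathrm{CS})$: from $\Pi,\Psi\to A$ infer $\Psi,\Pi\to A$. The calculus $\mathrm{L}^{\circlearrowleft}$ is obtained from $\mathrm{L}$ by adding the connective $^{\circlearrowleft}$ (so the rules above apply to all types of $\mathrm{L}^{\circlearrowleft}$) and the rules - $(\to^{\circlearrowleft})$: from $\Pi\to A$ infer $\Pi\to A^{\circlearrowleft}$. - $(^{\circlearrowleft}\to)$: from $B\to A^{\circlearrowleft}$ infer $B^{\circlearrowleft}\to A^{\circlearrowleft}$. - $(\circlearrowleft)$: from $\Pi,\Psi\to A^{\circlearrowleft}$ infer $\Psi,\Pi\to A^{\circlearrowleft}$. *)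

theory Defs
  imports Main
begin

(* The set Pr of primitive types is the type variable 'p, common to both calculi.
   Under A B  stands for  A \ B  and  Over B A  for  B / A ; in both cases A is the
   argument and B the result.  Cyc is the unary connective of the cyclic calculus. *)

datatype 'p ltype =
    Prim 'p
  | Under "'p ltype" "'p ltype"
  | Over "'p ltype" "'p ltype"
  | Prod "'p ltype" "'p ltype"

datatype 'p ctype =
    CPrim 'p
  | CUnder "'p ctype" "'p ctype"
  | COver "'p ctype" "'p ctype"
  | CProd "'p ctype" "'p ctype"
  | Cyc "'p ctype"

(* lcs is derivability in L + (CS), lcyc derivability in the calculus with Cyc.
   Capital Greek Pi and Psi range over nonempty sequences, which is what the side
   conditions record; Gamma and Delta may be empty.  Every derivable sequent
   therefore has a nonempty antecedent. *)

inductive lcs :: "'p ltype list \<Rightarrow> 'p ltype \<Rightarrow> bool" where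
  lcs_ax: "lcs [A] A"
| lcs_under_left:
    "lcs (\<Gamma> @ [B] @ \<Delta>) C \<Longrightarrow> lcs \<Pi> A \<Longrightarrow> \<Pi> \<noteq> [] \<Longrightarrow> lcs (\<Gamma> @ \<Pi> @ [Under A B] @ \<Delta>) C"
| lcs_under_right: "lcs ([A] @ \<Pi>) B \<Longrightarrow> \<Pi> \<noteq> [] \<Longrightarrow> lcs \<Pi> (Under A B)"
| lcs_over_left:
    "lcs (\<Gamma> @ [B] @ \<Delta>) C \<Longrightarrow> lcs \<Pi> A \<Longrightarrow> \<Pi> \<noteq> [] \<Longrightarrow> lcs (\<Gamma> @ [Over B A] @ \<Pi> @ \<Delta>) C"
| lcs_over_right: "lcs (\<Pi> @ [A]) B \<Longrightarrow> \<Pi> \<noteq> [] \<Longrightarrow> lcs \<Pi> (Over B A)"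
| lcs_prod_left: "lcs (\<Gamma> @ [A, B] @ \<Delta>) C \<Longrightarrow> lcs (\<Gamma> @ [Prod A B] @ \<Delta>) C"
| lcs_prod_right:
    "lcs \<Pi> A \<Longrightarrow> lcs \<Psi> B \<Longrightarrow> \<Pi> \<noteq> [] \<Longrightarrow> \<Psi> \<noteq> [] \<Longrightarrow> lcs (\<Pi> @ \<Psi>) (Prod A B)"
| lcs_cut: "lcs \<Pi> A \<Longrightarrow> lcs (\<Gamma> @ [A] @ \<Delta>) B \<Longrightarrow> \<Pi> \<noteq> [] \<Longrightarrow> lcs (\<Gamma> @ \<Pi> @ \<Delta>) B"
| lcs_cs: "lcs (\<Pi> @ \<Psi>) A \<Longrightarrow> \<Pi> \<noteq> [] \<Longrightarrow> \<Psi> \<noteq> [] \<Longrightarrow> lcs (\<Psi> @ \<Pi>) A"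

inductive lcyc :: "'p ctype list \<Rightarrow> 'p ctype \<Rightarrow> bool" where
  lcyc_ax: "lcyc [A] A"
| lcyc_under_left:
    "lcyc (\<Gamma> @ [B] @ \<Delta>) C \<Longrightarrow> lcyc \<Pi> A \<Longrightarrow> \<Pi> \<noteq> [] \<Longrightarrow> lcyc (\<Gamma> @ \<Pi> @ [CUnder A B] @ \<Delta>) C"
| lcyc_under_right: "lcyc ([A] @ \<Pi>) B \<Longrightarrow> \<Pi> \<noteq> [] \<Longrightarrow> lcyc \<Pi> (CUnder A B)"
| lcyc_over_left:
    "lcyc (\<Gamma> @ [B] @ \<Delta>) C \<Longrightarrow> lcyc \<Pi> A \<Longrightarrow> \<Pi> \<noteq> [] \<Longrightarrow> lcyc (\<Gamma> @ [COver B A] @ \<Pi> @ \<Delta>) C"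
| lcyc_over_right: "lcyc (\<Pi> @ [A]) B \<Longrightarrow> \<Pi> \<noteq> [] \<Longrightarrow> lcyc \<Pi> (COver B A)"
| lcyc_prod_left: "lcyc (\<Gamma> @ [A, B] @ \<Delta>) C \<Longrightarrow> lcyc (\<Gamma> @ [CProd A B] @ \<Delta>) C"
| lcyc_prod_right:
    "lcyc \<Pi> A \<Longrightarrow> lcyc \<Psi> B \<Longrightarrow> \<Pi> \<noteq> [] \<Longrightarrow> \<Psi> \<noteq> [] \<Longrightarrow> lcyc (\<Pi> @ \<Psi>) (CProd A B)"
| lcyc_cut: "lcyc \<Pi> A \<Longrightarrow> lcyc (\<Gamma> @ [A] @ \<Delta>) B \<Longrightarrow> \<Pi> \<noteq> [] \<Longrightarrow> lcyc (\<Gamma> @ \<Pi> @ \<Delta>) B"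
| lcyc_cyc_right: "lcyc \<Pi> A \<Longrightarrow> \<Pi> \<noteq> [] \<Longrightarrow> lcyc \<Pi> (Cyc A)"
| lcyc_cyc_left: "lcyc [B] (Cyc A) \<Longrightarrow> lcyc [Cyc B] (Cyc A)"
| lcyc_shift:
    "lcyc (\<Pi> @ \<Psi>) (Cyc A) \<Longrightarrow> \<Pi> \<noteq> [] \<Longrightarrow> \<Psi> \<noteq> [] \<Longrightarrow> lcyc (\<Psi> @ \<Pi>) (Cyc A)"

end

theory Submission
  imports Defs "HOL-Library.Multiset" "HOL-Library.Set_Algebras" "HOL-Library.Product_Plus"
begin

text \<open>
  Since \<open>A, B \<rightarrow> A \<cdot> B\<close> may be shifted, the rule (CS) together with cut makes L + (CS) the
  commutative Lambek calculus. Write \<open>\<bottom>\<close> for \<open>x\<^sup>c\<close>, where \<open>c\<close> is the cyclic connective and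
  \<open>x\<close> is a primitive type. A hypothesis is translated to
  \<open>\<bottom> / (N \<setminus> \<bottom>)\<^sup>c\<close> and a goal to \<open>\<bottom> / (P \<setminus> \<bottom>)\<close>. As long as the goal is \<open>\<bottom>\<close>, such a
  hypothesis can be replaced by \<open>N\<close> at an arbitrary place of the antecedent, which is all the
  exchange that a cut-free commutative proof needs. Conversely, in a commutative phase model the
  connective \<open>c\<close> may be read as the identity, and then both translations are the double
  negation of the same set. In a suitable model built from cut-free derivability this set tests
  derivability of the translated type; the same model eliminates cut from L + (CS).
\<close>

text \<open>Both directions of the equivalence pass through this cut-free calculus. Multisets absorb
  exchange, and identity axioms are primitive only; cut and compound identities return semantically
  in \<open>lcs_imp_lp\<close>.\<close>

inductive lp :: "'p ltype multiset \<Rightarrow> 'p ltype \<Rightarrow> bool" where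
  lp_ax: "lp {#Prim p#} (Prim p)"
| lp_under_left: "lp (add_mset B \<Gamma>) C \<Longrightarrow> lp \<Delta> A \<Longrightarrow> lp (add_mset (Under A B) (\<Gamma> + \<Delta>)) C"
| lp_over_left: "lp (add_mset B \<Gamma>) C \<Longrightarrow> lp \<Delta> A \<Longrightarrow> lp (add_mset (Over B A) (\<Gamma> + \<Delta>)) C"
| lp_under_right: "lp (add_mset A \<Gamma>) B \<Longrightarrow> \<Gamma> \<noteq> {#} \<Longrightarrow> lp \<Gamma> (Under A B)"
| lp_over_right: "lp (add_mset A \<Gamma>) B \<Longrightarrow> \<Gamma> \<noteq> {#} \<Longrightarrow> lp \<Gamma> (Over B A)"
| lp_prod_left: "lp (add_mset A (add_mset B \<Gamma>)) C \<Longrightarrow> lp (add_mset (Prod A B) \<Gamma>) C"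
| lp_prod_right: "lp \<Gamma> A \<Longrightarrow> lp \<Delta> B \<Longrightarrow> lp (\<Gamma> + \<Delta>) (Prod A B)"

lemma lp_nonempty: "lp \<Gamma> A \<Longrightarrow> \<Gamma> \<noteq> {#}"
  by (induction rule: lp.induct) auto

lemma lp_nonempty_list: "lp (mset \<Pi>) A \<Longrightarrow> \<Pi> \<noteq> []"
  using lp_nonempty by fastforce

lemma mset_eq_add_msetE:
  assumes "mset xs = add_mset a M"
  obtains ys zs where "xs = ys @ a # zs" "M = mset ys + mset zs"
proof -
  have "a \<in> set xs"
    using assms by (metis set_mset_mset union_single_eq_member)
  then obtain ys zs where "xs = ys @ a # zs"
    by (meson split_list)
  with assms that show ?thesis by simp
qed

section \<open>The cyclic shift rule is the exchange rule\<close>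

text \<open>Shifting \<open>A, B \<rightarrow> A \<cdot> B\<close> gives \<open>B, A \<rightarrow> A \<cdot> B\<close>; a cut with it exchanges \<open>A\<close> and \<open>B\<close> in any context.\<close>

lemma lcs_swap:
  assumes "lcs (\<Gamma> @ [A, B] @ \<Delta>) C"
  shows "lcs (\<Gamma> @ [B, A] @ \<Delta>) C"
proof -
  have "lcs ([A] @ [B]) (Prod A B)"
    by (rule lcs_prod_right) (auto intro: lcs_ax)
  then have "lcs ([B] @ [A]) (Prod A B)"
    by (rule lcs_cs) auto
  moreover have "lcs (\<Gamma> @ [Prod A B] @ \<Delta>) C"
    using assms by (rule lcs_prod_left)
  ultimately have "lcs (\<Gamma> @ ([B] @ [A]) @ \<Delta>) C"
    by (rule lcs_cut) auto
  then show ?thesis by simp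
qed

lemma lcs_move: "lcs (\<Gamma> @ \<Delta> @ A # \<Theta>) C \<Longrightarrow> lcs (\<Gamma> @ A # \<Delta> @ \<Theta>) C"
proof (induction \<Delta> arbitrary: \<Gamma>)
  case (Cons B \<Delta>)
  have "lcs (\<Gamma> @ [B, A] @ \<Delta> @ \<Theta>) C"
    using Cons.IH[of "\<Gamma> @ [B]"] Cons.prems by simp
  from lcs_swap[OF this] show ?case by simp
qed simp

lemma lcs_exchange:
  assumes "lcs \<Gamma> C" "mset \<Gamma> = mset \<Delta>"
  shows "lcs \<Delta> C"
proof -
  \<comment> \<open>The prefix collects the types already placed in their final order.\<close>
  have "lcs (\<Xi> @ \<Gamma>) C \<Longrightarrow> mset \<Gamma> = mset \<Delta> \<Longrightarrow> lcs (\<Xi> @ \<Delta>) C" for \<Xi> \<Gamma>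
  proof (induction \<Delta> arbitrary: \<Xi> \<Gamma>)
    case (Cons A \<Delta>)
    obtain \<Gamma>1 \<Gamma>2 where \<Gamma>: "\<Gamma> = \<Gamma>1 @ A # \<Gamma>2" "mset \<Delta> = mset \<Gamma>1 + mset \<Gamma>2"
      by (rule mset_eq_add_msetE[OF Cons.prems(2)[unfolded mset.simps]])
    have "lcs ((\<Xi> @ [A]) @ \<Gamma>1 @ \<Gamma>2) C"
      using lcs_move[OF Cons.prems(1)[unfolded \<Gamma>(1)]] by simp
    then have "lcs ((\<Xi> @ [A]) @ \<Delta>) C"
      by (rule Cons.IH) (simp add: \<Gamma>(2))
    then show ?case by simp
  qed simp
  from this[of "[]", unfolded append_Nil, OF assms] show ?thesis .
qed

lemma lp_imp_lcs: "lp M A \<Longrightarrow> mset \<Pi> = M \<Longrightarrow> lcs \<Pi> A"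
proof (induction arbitrary: \<Pi> rule: lp.induct)
  case (lp_ax p)
  then show ?case by (simp add: lcs_ax)
next
  case (lp_under_left B \<Gamma> C \<Delta> A)
  obtain g d where gd: "mset g = \<Gamma>" "mset d = \<Delta>"
    using ex_mset by metis
  then have "lcs ([] @ [B] @ g) C" "lcs d A" "d \<noteq> []"
    using lp_under_left lp_nonempty_list by auto
  then have "lcs ([] @ d @ [Under A B] @ g) C"
    by (rule lcs_under_left)
  then show ?case
    by (rule lcs_exchange) (use gd lp_under_left in auto)
next
  case (lp_over_left B \<Gamma> C \<Delta> A)
  obtain g d where gd: "mset g = \<Gamma>" "mset d = \<Delta>"
    using ex_mset by metis
  then have "lcs ([] @ [B] @ g) C" "lcs d A" "d \<noteq> []"
    using lp_over_left lp_nonempty_list by auto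
  then have "lcs ([] @ [Over B A] @ d @ g) C"
    by (rule lcs_over_left)
  then show ?case
    by (rule lcs_exchange) (use gd lp_over_left in auto)
next
  case (lp_under_right A \<Gamma> B)
  then show ?case by (intro lcs_under_right) auto
next
  case (lp_over_right A \<Gamma> B)
  then show ?case by (intro lcs_over_right) auto
next
  case (lp_prod_left A B \<Gamma> C)
  obtain g where g: "mset g = \<Gamma>"
    using ex_mset by metis
  then have "lcs ([] @ [A, B] @ g) C"
    using lp_prod_left by auto
  then have "lcs ([] @ [Prod A B] @ g) C"
    by (rule lcs_prod_left)
  then show ?case
    by (rule lcs_exchange) (use g lp_prod_left in auto)
next
  case (lp_prod_right \<Gamma> A \<Delta> B)
  obtain g d where gd: "mset g = \<Gamma>" "mset d = \<Delta>"
    using ex_mset by metis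
  then have "lcs (g @ d) (Prod A B)"
    using lp_prod_right lp_nonempty_list by (intro lcs_prod_right) auto
  then show ?case
    by (rule lcs_exchange) (use gd lp_prod_right in auto)
qed

section \<open>The translations\<close>

abbreviation cbot :: "'p \<Rightarrow> 'p ctype" where
  "cbot x \<equiv> Cyc (CPrim x)"

definition dneg :: "'p \<Rightarrow> 'p ctype \<Rightarrow> 'p ctype" where
  "dneg x X = COver (cbot x) (CUnder X (cbot x))"

definition lift :: "'p \<Rightarrow> 'p ctype \<Rightarrow> 'p ctype" where
  "lift x X = COver (cbot x) (Cyc (CUnder X (cbot x)))"

text \<open>There may be no primitive type other than \<open>x\<close>, so \<open>x\<close> has to be encoded by a compound type.\<close>

definition atom :: "'p \<Rightarrow> 'p \<Rightarrow> 'p ctype" where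
  "atom x p = (if p = x then CUnder (CProd (cbot x) (cbot x)) (cbot x) else CPrim p)"

text \<open>Guards follow polarity: subtypes that become hypotheses in a cut-free derivation get
  \<open>lift\<close>, those that become goals get \<open>dneg\<close>. The outermost guard is left
  off, so that it can be added only when a type has to move.\<close>

fun ant :: "'p \<Rightarrow> 'p ltype \<Rightarrow> 'p ctype" and suc :: "'p \<Rightarrow> 'p ltype \<Rightarrow> 'p ctype" where
  "ant x (Prim p) = atom x p"
| "ant x (Under A B) = CUnder (dneg x (suc x A)) (lift x (ant x B))"
| "ant x (Over B A) = COver (lift x (ant x B)) (dneg x (suc x A))"
| "ant x (Prod A B) = CProd (lift x (ant x A)) (lift x (ant x B))"
| "suc x (Prim p) = atom x p"
| "suc x (Under A B) = CUnder (lift x (ant x A)) (dneg x (suc x B))"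
| "suc x (Over B A) = COver (dneg x (suc x B)) (lift x (ant x A))"
| "suc x (Prod A B) = CProd (dneg x (suc x A)) (dneg x (suc x B))"

lemma lcyc_rotate: "lcyc (\<Gamma> @ \<Delta>) (Cyc A) \<Longrightarrow> lcyc (\<Delta> @ \<Gamma>) (Cyc A)"
  by (cases "\<Gamma> = [] \<or> \<Delta> = []") (auto intro: lcyc_shift)

text \<open>The inner modality lets the remaining antecedent rotate before \<open>X\<close> is put back,
  so \<open>lift x X\<close> may stand anywhere in the cyclic word.\<close>

lemma lcyc_lift_move:
  assumes "lcyc (X # \<Gamma> @ \<Delta>) (cbot x)" "\<Gamma> @ \<Delta> \<noteq> []"
  shows "lcyc (lift x X # \<Delta> @ \<Gamma>) (cbot x)"
proof -
  have "lcyc (\<Gamma> @ \<Delta>) (CUnder X (cbot x))"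
    using assms by (intro lcyc_under_right) auto
  then have "lcyc (\<Delta> @ \<Gamma>) (Cyc (CUnder X (cbot x)))"
    using assms by (intro lcyc_rotate[of \<Gamma>] lcyc_cyc_right)
  then have "lcyc ([] @ [lift x X] @ (\<Delta> @ \<Gamma>) @ []) (cbot x)"
    unfolding lift_def using assms(2)
    by (intro lcyc_over_left) (auto intro: lcyc_ax)
  then show ?thesis by simp
qed

lemma lcyc_lift:
  assumes "lcyc (\<Gamma> @ X # \<Delta>) (cbot x)" "\<Gamma> @ \<Delta> \<noteq> []"
  shows "lcyc (\<Gamma> @ lift x X # \<Delta>) (cbot x)"
proof -
  have "lcyc (X # (\<Delta> @ \<Gamma>) @ []) (cbot x)"
    using lcyc_rotate[OF assms(1)] by simp
  then have "lcyc ((lift x X # \<Delta>) @ \<Gamma>) (cbot x)"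
    using lcyc_lift_move[of X "\<Delta> @ \<Gamma>" "[]" x] assms by auto
  then show ?thesis
    using lcyc_rotate by fastforce
qed

text \<open>Cut inverts the right rule of \<open>COver\<close>. The goal becomes the modal type
  \<open>cbot x\<close>, so rotation applies, while \<open>CUnder X (cbot x)\<close> remembers where
  the antecedent ended.\<close>

lemma lcyc_dneg_iff:
  assumes "\<Gamma> \<noteq> []"
  shows "lcyc \<Gamma> (dneg x X) \<longleftrightarrow> lcyc (\<Gamma> @ [CUnder X (cbot x)]) (cbot x)"
proof
  assume "lcyc \<Gamma> (dneg x X)"
  moreover have "lcyc ([] @ [dneg x X] @ [CUnder X (cbot x)] @ []) (cbot x)"
    unfolding dneg_def by (intro lcyc_over_left) (auto intro: lcyc_ax)
  ultimately show "lcyc (\<Gamma> @ [CUnder X (cbot x)]) (cbot x)"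
    using lcyc_cut[of \<Gamma> "dneg x X" "[]"] assms by auto
qed (use assms in \<open>auto simp: dneg_def intro: lcyc_over_right\<close>)

lemma lcyc_dneg:
  assumes "lcyc \<Gamma> X" "\<Gamma> \<noteq> []"
  shows "lcyc \<Gamma> (dneg x X)"
proof -
  have "lcyc ([] @ \<Gamma> @ [CUnder X (cbot x)] @ []) (cbot x)"
    using assms by (intro lcyc_under_left) (auto intro: lcyc_ax)
  then show ?thesis
    using assms by (simp add: lcyc_dneg_iff)
qed

lemma lcyc_lift_dneg:
  assumes "lcyc (\<Gamma> @ X # \<Delta>) (dneg x C)"
  shows "lcyc (\<Gamma> @ lift x X # \<Delta>) (dneg x C)"
  using assms lcyc_lift[of \<Gamma> X "\<Delta> @ [CUnder C (cbot x)]" x]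
  by (simp add: lcyc_dneg_iff)

text \<open>The antecedent together with the end marker \<open>?R\<close> is a cyclic word, and
  \<open>?R\<close> also keeps the rest of it nonempty. The three destinations serve the lifting of
  all hypotheses, the rules for \<open>Under\<close> and \<open>Prod\<close>, and the rule for
  \<open>Over\<close>.\<close>

lemma lcyc_lift_move_dneg:
  assumes "lcyc (\<Gamma> @ X # \<Delta> @ \<Theta>) (dneg x C)"
  shows "lcyc (\<Gamma> @ \<Delta> @ lift x X # \<Theta>) (dneg x C)" "lcyc (lift x X # \<Gamma> @ \<Delta> @ \<Theta>) (dneg x C)"
    "lcyc (\<Gamma> @ \<Delta> @ \<Theta> @ [lift x X]) (dneg x C)"
proof -
  let ?R = "CUnder C (cbot x)"
  have "lcyc (\<Gamma> @ (X # \<Delta> @ \<Theta> @ [?R])) (cbot x)"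
    using assms by (simp add: lcyc_dneg_iff)
  from lcyc_rotate[OF this]
  have X: "lcyc (X # \<Delta> @ \<Theta> @ ?R # \<Gamma>) (cbot x)"
    by simp
  have "lcyc ((lift x X # \<Theta> @ [?R]) @ \<Gamma> @ \<Delta>) (cbot x)"
    using lcyc_lift_move[of X \<Delta> "\<Theta> @ ?R # \<Gamma>" x] X by simp
  from lcyc_rotate[OF this] show "lcyc (\<Gamma> @ \<Delta> @ lift x X # \<Theta>) (dneg x C)"
    by (simp add: lcyc_dneg_iff)
  show "lcyc (lift x X # \<Gamma> @ \<Delta> @ \<Theta>) (dneg x C)"
    using lcyc_lift_move[of X "\<Delta> @ \<Theta> @ [?R]" \<Gamma> x] X by (simp add: lcyc_dneg_iff)
  have "lcyc ((lift x X # [?R]) @ \<Gamma> @ \<Delta> @ \<Theta>) (cbot x)"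
    using lcyc_lift_move[of X "\<Delta> @ \<Theta>" "?R # \<Gamma>" x] X by simp
  from lcyc_rotate[OF this] show "lcyc (\<Gamma> @ \<Delta> @ \<Theta> @ [lift x X]) (dneg x C)"
    by (simp add: lcyc_dneg_iff)
qed

text \<open>Hypotheses without the outer \<open>lift\<close> cannot move, so only some order of
  \<open>M\<close> is claimed, each rule choosing one that suits it. A type is lifted when it
  becomes part of a principal type.\<close>

lemma lp_imp_lcyc_ant:
  "lp M C \<Longrightarrow> \<exists>\<Pi>. mset \<Pi> = M \<and> lcyc (map (ant x) \<Pi>) (dneg x (suc x C))"
proof (induction rule: lp.induct)
  case (lp_ax p)
  show ?case
    by (rule exI[of _ "[Prim p]"]) (auto intro: lcyc_dneg lcyc_ax)
next
  case (lp_under_left B \<Gamma> C \<Delta> A)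
  obtain g d where g: "mset g = add_mset B \<Gamma>" "lcyc (map (ant x) g) (dneg x (suc x C))"
    and d: "mset d = \<Delta>" "lcyc (map (ant x) d) (dneg x (suc x A))"
    using lp_under_left by blast
  obtain g1 g2 where g12: "g = g1 @ B # g2" "\<Gamma> = mset g1 + mset g2"
    using g(1) by (rule mset_eq_add_msetE)
  have "lcyc (map (ant x) g1 @ [lift x (ant x B)] @ map (ant x) g2) (dneg x (suc x C))"
    using lcyc_lift_dneg g(2) g12 by fastforce
  then have "lcyc (map (ant x) g1 @ map (ant x) d @ [ant x (Under A B)] @ map (ant x) g2) (dneg x (suc x C))"
    unfolding ant.simps by (rule lcyc_under_left) (use d lp_under_left lp_nonempty_list in auto)
  then show ?case
    by (intro exI[of _ "g1 @ d @ [Under A B] @ g2"]) (use g12 d in auto)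
next
  case (lp_over_left B \<Gamma> C \<Delta> A)
  obtain g d where g: "mset g = add_mset B \<Gamma>" "lcyc (map (ant x) g) (dneg x (suc x C))"
    and d: "mset d = \<Delta>" "lcyc (map (ant x) d) (dneg x (suc x A))"
    using lp_over_left by blast
  obtain g1 g2 where g12: "g = g1 @ B # g2" "\<Gamma> = mset g1 + mset g2"
    using g(1) by (rule mset_eq_add_msetE)
  have "lcyc (map (ant x) g1 @ [lift x (ant x B)] @ map (ant x) g2) (dneg x (suc x C))"
    using lcyc_lift_dneg g(2) g12 by fastforce
  then have "lcyc (map (ant x) g1 @ [ant x (Over B A)] @ map (ant x) d @ map (ant x) g2) (dneg x (suc x C))"
    unfolding ant.simps by (rule lcyc_over_left) (use d lp_over_left lp_nonempty_list in auto)
  then show ?case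
    by (intro exI[of _ "g1 @ [Over B A] @ d @ g2"]) (use g12 d in auto)
next
  case (lp_under_right A \<Gamma> B)
  obtain g where g: "mset g = add_mset A \<Gamma>" "lcyc (map (ant x) g) (dneg x (suc x B))"
    using lp_under_right by blast
  obtain g1 g2 where g12: "g = g1 @ A # g2" "\<Gamma> = mset g1 + mset g2"
    using g(1) by (rule mset_eq_add_msetE)
  have ne: "map (ant x) (g1 @ g2) \<noteq> []"
    using g12 lp_under_right by auto
  have "lcyc ([lift x (ant x A)] @ map (ant x) (g1 @ g2)) (dneg x (suc x B))"
    using lcyc_lift_move_dneg(2)[of "map (ant x) g1" _ "map (ant x) g2" "[]"] g(2) g12 by simp
  then have "lcyc (map (ant x) (g1 @ g2)) (suc x (Under A B))"
    unfolding suc.simps by (rule lcyc_under_right) (rule ne)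
  then show ?case
    by (intro exI[of _ "g1 @ g2"]) (use ne g12 in \<open>auto intro!: lcyc_dneg\<close>)
next
  case (lp_over_right A \<Gamma> B)
  obtain g where g: "mset g = add_mset A \<Gamma>" "lcyc (map (ant x) g) (dneg x (suc x B))"
    using lp_over_right by blast
  obtain g1 g2 where g12: "g = g1 @ A # g2" "\<Gamma> = mset g1 + mset g2"
    using g(1) by (rule mset_eq_add_msetE)
  have ne: "map (ant x) (g1 @ g2) \<noteq> []"
    using g12 lp_over_right by auto
  have "lcyc (map (ant x) (g1 @ g2) @ [lift x (ant x A)]) (dneg x (suc x B))"
    using lcyc_lift_move_dneg(3)[of "map (ant x) g1" _ "map (ant x) g2" "[]"] g(2) g12 by simp
  then have "lcyc (map (ant x) (g1 @ g2)) (suc x (Over B A))"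
    unfolding suc.simps by (rule lcyc_over_right) (rule ne)
  then show ?case
    by (intro exI[of _ "g1 @ g2"]) (use ne g12 in \<open>auto intro!: lcyc_dneg\<close>)
next
  case (lp_prod_left A B \<Gamma> C)
  obtain g where g: "mset g = add_mset A (add_mset B \<Gamma>)" "lcyc (map (ant x) g) (dneg x (suc x C))"
    using lp_prod_left by blast
  obtain g1 g2 where g12: "g = g1 @ B # g2" "add_mset A \<Gamma> = mset (g1 @ g2)"
    using g(1) by (metis add_mset_commute mset_append mset_eq_add_msetE)
  \<comment> \<open>\<open>B\<close> goes to the front first, so that \<open>A\<close>, moved there
    next, lands directly to its left.\<close>
  have B: "lcyc (lift x (ant x B) # map (ant x) (g1 @ g2)) (dneg x (suc x C))"
    using lcyc_lift_move_dneg(2)[of "map (ant x) g1" _ "map (ant x) g2" "[]"] g(2) g12 by simp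
  obtain h1 h2 where h12: "g1 @ g2 = h1 @ A # h2" "\<Gamma> = mset h1 + mset h2"
    using g12(2)[symmetric] by (rule mset_eq_add_msetE)
  have "lcyc ([lift x (ant x A), lift x (ant x B)] @ map (ant x) (h1 @ h2)) (dneg x (suc x C))"
    using lcyc_lift_move_dneg(2)[of "lift x (ant x B) # map (ant x) h1" _ "map (ant x) h2" "[]"] B
    unfolding h12 by simp
  then have "lcyc ([] @ [ant x (Prod A B)] @ map (ant x) (h1 @ h2)) (dneg x (suc x C))"
    unfolding ant.simps by (intro lcyc_prod_left) simp
  then show ?case
    by (intro exI[of _ "Prod A B # h1 @ h2"]) (use h12 in auto)
next
  case (lp_prod_right \<Gamma> A \<Delta> B)
  obtain g d where g: "mset g = \<Gamma>" "lcyc (map (ant x) g) (dneg x (suc x A))"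
    and d: "mset d = \<Delta>" "lcyc (map (ant x) d) (dneg x (suc x B))"
    using lp_prod_right by blast
  have ne: "g \<noteq> []" "d \<noteq> []"
    using g d lp_prod_right lp_nonempty_list by auto
  then have "lcyc (map (ant x) g @ map (ant x) d) (suc x (Prod A B))"
    using g d by (auto intro: lcyc_prod_right)
  then show ?case
    by (intro exI[of _ "g @ d"]) (use ne g d in \<open>auto intro!: lcyc_dneg\<close>)
qed

text \<open>A type can be pulled from anywhere to the left edge of the finished part
  \<open>Y\<close>; filling from right to left produces any prescribed order.\<close>

lemma lcyc_lift_all:
  "lcyc (map f \<Gamma> @ Y) (dneg x C) \<Longrightarrow> mset \<Gamma> = mset \<Delta>
    \<Longrightarrow> lcyc (map (\<lambda>A. lift x (f A)) \<Delta> @ Y) (dneg x C)"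
proof (induction \<Delta> arbitrary: \<Gamma> Y rule: rev_induct)
  case (snoc A \<Delta>)
  obtain \<Gamma>1 \<Gamma>2 where \<Gamma>: "\<Gamma> = \<Gamma>1 @ A # \<Gamma>2" "mset \<Delta> = mset \<Gamma>1 + mset \<Gamma>2"
    using mset_eq_add_msetE[of \<Gamma> A "mset \<Delta>"] snoc.prems(2) by auto
  have "lcyc (map f (\<Gamma>1 @ \<Gamma>2) @ lift x (f A) # Y) (dneg x C)"
    using lcyc_lift_move_dneg(1)[of "map f \<Gamma>1" "f A" "map f \<Gamma>2" Y] snoc.prems(1) \<Gamma> by simp
  from snoc.IH[OF this] show ?case
    using \<Gamma> by simp
qed simp

lemma lp_imp_lcyc:
  assumes "lp (mset \<Pi>) C"
  shows "lcyc (map (\<lambda>A. lift x (ant x A)) \<Pi>) (dneg x (suc x C))"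
proof -
  obtain \<Pi>' where "mset \<Pi>' = mset \<Pi>" "lcyc (map (ant x) \<Pi>') (dneg x (suc x C))"
    using lp_imp_lcyc_ant[OF assms] by blast
  then show ?thesis
    using lcyc_lift_all[of "ant x" \<Pi>' "[]"] by simp
qed

section \<open>Commutative models\<close>

text \<open>Zero plays the empty antecedent; the extra axiom keeps sums of nonempty antecedents
  nonempty.\<close>

class conical_monoid_add = comm_monoid_add +
  assumes add_eq_0D: "a + b = 0 \<Longrightarrow> a = 0"

instance multiset :: (type) conical_monoid_add
  by standard simp

instance prod :: (conical_monoid_add, conical_monoid_add) conical_monoid_add
  by standard (auto simp: zero_prod_def dest: add_eq_0D)

text \<open>The residual of the power set of the monoid, without zero because the right rules demand
  a nonempty antecedent.\<close>

definition res :: "'m::conical_monoid_add set \<Rightarrow> 'm set \<Rightarrow> 'm set" where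
  "res X Y = {m. m \<noteq> 0 \<and> (\<forall>a\<in>X. a + m \<in> Y)}"

lemma zero_notin_res: "0 \<notin> res X Y"
  by (simp add: res_def)

lemma subset_res_iff: "Z \<subseteq> res X Y \<longleftrightarrow> 0 \<notin> Z \<and> X + Z \<subseteq> Y"
  by (auto simp: res_def set_plus_def)

lemma res_app: "X + res X Y \<subseteq> Y"
  by (auto simp: res_def set_plus_def)

lemma zero_notin_plus: "(0::'m::conical_monoid_add) \<notin> X \<Longrightarrow> 0 \<notin> X + Y"
  by (auto simp: set_plus_def dest: add_eq_0D)

lemma zero_notin_sum_list:
  "\<Gamma> \<noteq> [] \<Longrightarrow> (\<And>A. (0::'m::conical_monoid_add) \<notin> f A) \<Longrightarrow> 0 \<notin> sum_list (map f \<Gamma>)"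
  by (cases \<Gamma>) (auto simp: zero_notin_plus)

fun den :: "('p \<Rightarrow> 'm::conical_monoid_add set) \<Rightarrow> 'p ctype \<Rightarrow> 'm set" where
  "den v (CPrim p) = v p"
| "den v (CUnder A B) = res (den v A) (den v B)"
| "den v (COver B A) = res (den v A) (den v B)"
| "den v (CProd A B) = den v A + den v B"
| "den v (Cyc A) = den v A"

lemma zero_notin_den: "(\<And>p. 0 \<notin> v p) \<Longrightarrow> 0 \<notin> den v A"
  by (induction A) (auto simp: zero_notin_res zero_notin_plus)

lemma plus_cut:
  fixes X :: "'m::comm_monoid_add set"
  assumes "X \<subseteq> Y" "G + (Y + D) \<subseteq> Z"
  shows "G + (X + D) \<subseteq> Z"
  using assms by (meson order_refl order_trans set_plus_mono2)

lemma plus_res_cut: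
  fixes X :: "'m::conical_monoid_add set"
  assumes "P \<subseteq> X" "G + (Y + D) \<subseteq> Z"
  shows "G + (P + (res X Y + D)) \<subseteq> Z"
proof -
  have "P + res X Y \<subseteq> Y"
    using assms(1) res_app by (meson order_refl order_trans set_plus_mono2)
  from plus_cut[OF this assms(2)] show ?thesis
    by (simp add: add.assoc)
qed

text \<open>With \<open>Cyc\<close> read as the identity, two of its rules are trivial and the shift
  is commutativity of addition.\<close>

lemma den_sound:
  assumes v: "\<And>p. 0 \<notin> v p"
  shows "lcyc \<Gamma> A \<Longrightarrow> sum_list (map (den v) \<Gamma>) \<subseteq> den v A"
proof (induction rule: lcyc.induct)
  case (lcyc_under_left \<Gamma> B \<Delta> C \<Pi> A)
  then show ?case by (simp add: plus_res_cut)
next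
  case (lcyc_over_left \<Gamma> B \<Delta> C \<Pi> A)
  then show ?case
    using plus_res_cut[of "sum_list (map (den v) \<Pi>)" "den v A" "sum_list (map (den v) \<Gamma>)" "den v B"]
    by (simp add: add.left_commute)
next
  case (lcyc_under_right A \<Pi> B)
  then show ?case
    using zero_notin_sum_list[of \<Pi> "den v"] zero_notin_den[of v] v by (simp add: subset_res_iff)
next
  case (lcyc_over_right \<Pi> A B)
  then show ?case
    using zero_notin_sum_list[of \<Pi> "den v"] zero_notin_den[of v] v
    by (simp add: subset_res_iff add.commute)
next
  case (lcyc_cut \<Pi> A \<Gamma> \<Delta> B)
  then show ?case by (simp add: plus_cut)
next
  case (lcyc_shift \<Pi> \<Psi> A)
  then show ?case by (simp add: add.commute)
qed (simp_all add: add.assoc set_plus_mono2)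

section \<open>Double negation semantics of L + (CS)\<close>

abbreviation biorth :: "'m::conical_monoid_add set \<Rightarrow> 'm set \<Rightarrow> 'm set" where
  "biorth Z X \<equiv> res (res X Z) Z"

lemma subset_biorth: "0 \<notin> X \<Longrightarrow> X \<subseteq> biorth Z X"
  by (simp add: subset_res_iff) (metis add.commute res_app)

text \<open>Currying: for \<open>u\<close> orthogonal to \<open>W\<close>, the sum
  \<open>y + u\<close> is orthogonal to \<open>X\<close>, hence to its closure. So a hypothesis may
  be closed whenever the conclusion is.\<close>

lemma biorth_plus:
  assumes "X + Y \<subseteq> biorth Z W"
  shows "biorth Z X + Y \<subseteq> biorth Z W"
proof -
  have "a + y + u \<in> Z" if a: "a \<in> biorth Z X" and y: "y \<in> Y" and u: "u \<in> res W Z" for a y u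
  proof -
    have "b + (y + u) \<in> Z" if "b \<in> X" for b
    proof -
      have "u + (b + y) \<in> Z"
        using assms set_plus_intro[OF that y] u by (auto simp: res_def)
      then show ?thesis
        by (simp add: ac_simps)
    qed
    moreover have "y + u \<noteq> 0"
      using u add_eq_0D[of u y] by (auto simp: res_def add.commute)
    ultimately have "y + u \<in> res X Z"
      by (simp add: res_def)
    then show ?thesis
      using a by (auto simp: res_def add.commute add.left_commute)
  qed
  then show ?thesis
    by (auto simp: subset_res_iff zero_notin_plus zero_notin_res)
       (auto simp: set_plus_def add.commute)
qed

text \<open>The meaning before its outermost closure, just as \<open>ant\<close> and
  \<open>suc\<close> omit their outermost guard; this makes \<open>den_ant_suc\<close> an
  equality.\<close>

fun core :: "'m::conical_monoid_add set \<Rightarrow> ('p \<Rightarrow> 'm set) \<Rightarrow> 'p ltype \<Rightarrow> 'm set" where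
  "core Z v (Prim p) = v p"
| "core Z v (Under A B) = res (biorth Z (core Z v A)) (biorth Z (core Z v B))"
| "core Z v (Over B A) = res (biorth Z (core Z v A)) (biorth Z (core Z v B))"
| "core Z v (Prod A B) = biorth Z (core Z v A) + biorth Z (core Z v B)"

abbreviation sem :: "'m::conical_monoid_add set \<Rightarrow> ('p \<Rightarrow> 'm set) \<Rightarrow> 'p ltype \<Rightarrow> 'm set" where
  "sem Z v A \<equiv> biorth Z (core Z v A)"

lemma zero_notin_core: "(\<And>p. 0 \<notin> v p) \<Longrightarrow> 0 \<notin> core Z v A"
  by (induction A) (auto simp: zero_notin_res zero_notin_plus)

lemma sem_cut:
  assumes "G + (core Z v A + D) \<subseteq> sem Z v C"
  shows "G + (sem Z v A + D) \<subseteq> sem Z v C"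
  using biorth_plus[of "core Z v A" "G + D" "core Z v C" Z] assms by (simp add: add.left_commute)

lemma core_subset_sem: "(\<And>p. 0 \<notin> v p) \<Longrightarrow> core Z v A \<subseteq> sem Z v A"
  by (intro subset_biorth zero_notin_core)

lemma sem_sound:
  assumes v: "\<And>p. 0 \<notin> v p"
  shows "lcs \<Gamma> A \<Longrightarrow> sum_list (map (sem Z v) \<Gamma>) \<subseteq> sem Z v A"
proof (induction rule: lcs.induct)
  case (lcs_under_left \<Gamma> B \<Delta> C \<Pi> A)
  have "sum_list (map (sem Z v) \<Gamma>) + (sum_list (map (sem Z v) \<Pi>)
      + (core Z v (Under A B) + sum_list (map (sem Z v) \<Delta>))) \<subseteq> sem Z v C"
    using lcs_under_left by (simp add: plus_res_cut)
  from sem_cut[of "sum_list (map (sem Z v) \<Gamma>) + sum_list (map (sem Z v) \<Pi>)", unfolded add.assoc, OF this]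
  show ?case by simp
next
  case (lcs_over_left \<Gamma> B \<Delta> C \<Pi> A)
  have "sum_list (map (sem Z v) \<Gamma>) + (sum_list (map (sem Z v) \<Pi>)
      + (core Z v (Over B A) + sum_list (map (sem Z v) \<Delta>))) \<subseteq> sem Z v C"
    using lcs_over_left by (simp add: plus_res_cut)
  from sem_cut[of "sum_list (map (sem Z v) \<Gamma>) + sum_list (map (sem Z v) \<Pi>)", unfolded add.assoc, OF this]
  show ?case by (simp add: add.left_commute)
next
  case (lcs_under_right A \<Pi> B)
  then have "sum_list (map (sem Z v) \<Pi>) \<subseteq> core Z v (Under A B)"
    by (simp add: subset_res_iff zero_notin_sum_list zero_notin_res)
  then show ?case using core_subset_sem[of v] v by blast
next
  case (lcs_over_right \<Pi> A B)
  then have "sum_list (map (sem Z v) \<Pi>) \<subseteq> core Z v (Over B A)"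
    by (simp add: subset_res_iff zero_notin_sum_list zero_notin_res add.commute)
  then show ?case using core_subset_sem[of v] v by blast
next
  case (lcs_prod_left \<Gamma> A B \<Delta> C)
  then show ?case
    using sem_cut[of "sum_list (map (sem Z v) \<Gamma>)" Z v "Prod A B"] by (simp add: add.assoc)
next
  case (lcs_prod_right \<Pi> A \<Psi> B)
  then have "sum_list (map (sem Z v) (\<Pi> @ \<Psi>)) \<subseteq> core Z v (Prod A B)"
    by (simp add: set_plus_mono2)
  then show ?case using core_subset_sem[of v] v by blast
next
  case (lcs_cut \<Pi> A \<Gamma> \<Delta> B)
  then show ?case by (simp add: plus_cut)
next
  case (lcs_cs \<Pi> \<Psi> A)
  then show ?case by (simp add: add.commute)
qed simp

lemma den_dneg: "den v (dneg x X) = biorth (v x) (den v X)"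
  and den_lift: "den v (lift x X) = biorth (v x) (den v X)"
  by (simp_all add: dneg_def lift_def)

text \<open>A commutative model does not see the modality, so both translations have the same meaning.\<close>

lemma den_ant_suc:
  assumes "\<And>p. den v (atom x p) = w p"
  shows "den v (ant x A) = core (v x) w A" "den v (suc x A) = core (v x) w A"
  using assms by (induction A) (simp_all add: den_dneg den_lift)

section \<open>The canonical model\<close>

text \<open>Elements are pairs \<open>(\<Gamma>, W)\<close> of a multiset of types and a multiset of markers. The marker
  \<open>Some A\<close> asks for a derivation of \<open>A\<close>. The marker \<open>None\<close> makes it possible to define
  the meaning of \<open>Prim x\<close> from \<open>pole x\<close>: two copies of it ask for a derivation of \<open>Prim x\<close>.\<close>

type_synonym 'p elem = "'p ltype multiset \<times> 'p ltype option multiset"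

text \<open>This set must interpret \<open>Prim x\<close> in the cyclic calculus. Unmarked elements
  are excluded; two or more markers impose nothing, except for the pair of
  \<open>None\<close>.\<close>

definition pole :: "'p \<Rightarrow> 'p elem set" where
  "pole x = {(\<Gamma>, W). (W = {#None#} \<and> \<Gamma> = {#}) \<or> (\<exists>A. W = {#Some A#} \<and> lp \<Gamma> A)
     \<or> (W = {#None, None#} \<and> lp \<Gamma> (Prim x)) \<or> (2 \<le> size W \<and> W \<noteq> {#None, None#})}"

text \<open>Only unmarked elements represent antecedents, so marked ones are left
  unconstrained.\<close>

definition marked_or_derives :: "'p ltype \<Rightarrow> 'p elem set" where
  "marked_or_derives A = {(\<Gamma>, W). W = {#} \<longrightarrow> lp \<Gamma> A}"

definition val :: "'p \<Rightarrow> 'p \<Rightarrow> 'p elem set" where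
  "val x p = (if p = x then pole x else {(\<Gamma>, {#}) | \<Gamma>. lp \<Gamma> (Prim p)})"

definition atom_val :: "'p \<Rightarrow> 'p \<Rightarrow> 'p elem set" where
  "atom_val x p = den (val x) (atom x p)"

abbreviation hyp :: "'p ltype \<Rightarrow> 'p elem" where
  "hyp A \<equiv> ({#A#}, {#})"

lemma zero_notin_val: "0 \<notin> val x p"
  by (auto simp: val_def pole_def zero_prod_def dest: lp_nonempty)

lemma zero_notin_atom_val: "0 \<notin> atom_val x p"
  unfolding atom_val_def by (intro zero_notin_den zero_notin_val)

lemma size_2_cases:
  assumes "W \<noteq> {#}" "V \<noteq> {#}"
  shows "2 \<le> size (V + W)"
  using assms by (cases V; cases W) auto

lemma pole_Some: "(\<Gamma>, {#Some A#}) \<in> pole x \<longleftrightarrow> lp \<Gamma> A"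
  by (auto simp: pole_def)

lemma add_Some_in_pole:
  "W \<noteq> {#} \<Longrightarrow> (\<Gamma>, add_mset (Some A) W) \<in> pole x"
  by (cases W) (auto simp: pole_def add_eq_conv_ex)

text \<open>The single test \<open>({#}, {#Some A#})\<close> is orthogonal to \<open>X\<close>, and
  an unmarked element passes it only by deriving \<open>A\<close>.\<close>

lemma biorth_marked_or_derives:
  assumes "X \<subseteq> marked_or_derives A"
  shows "biorth (pole x) X \<subseteq> marked_or_derives A"
proof clarify
  fix \<Gamma> W assume m: "(\<Gamma>, W) \<in> biorth (pole x) X"
  have "({#}, {#Some A#}) \<in> res X (pole x)"
  proof -
    have "a + ({#}, {#Some A#}) \<in> pole x" if "a \<in> X" for a
    proof -
      obtain \<Delta> V where a: "a = (\<Delta>, V)"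
        by (cases a)
      show ?thesis
        using assms that unfolding a
        by (cases "V = {#}") (auto simp: marked_or_derives_def pole_Some add_Some_in_pole)
    qed
    then show ?thesis
      by (auto simp: res_def zero_prod_def)
  qed
  with m have "(\<Gamma>, add_mset (Some A) W) \<in> pole x"
    by (force simp: res_def)
  then show "(\<Gamma>, W) \<in> marked_or_derives A"
    by (auto simp: marked_or_derives_def pole_Some)
qed

lemma pole_prod_left: "u + hyp A + hyp B \<in> pole x \<Longrightarrow> u + hyp (Prod A B) \<in> pole x"
  by (cases u) (auto simp: pole_def add_mset_commute[of B A] intro: lp_prod_left)

text \<open>Covers both left rules through \<open>D\<close>. An unmarked \<open>d\<close> lets the
  rule act on the derivation requested by \<open>u\<close>; a marked \<open>d\<close> adds enough
  markers to land in the pole for free.\<close>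

lemma pole_left:
  assumes "u + hyp B \<in> pole x" "d \<in> marked_or_derives A"
    and D: "\<And>\<Gamma> \<Delta> C. lp (add_mset B \<Gamma>) C \<Longrightarrow> lp \<Delta> A \<Longrightarrow> lp (add_mset D (\<Gamma> + \<Delta>)) C"
  shows "u + d + hyp D \<in> pole x"
proof -
  obtain \<Gamma> W \<Delta> V where ud: "u = (\<Gamma>, W)" "d = (\<Delta>, V)"
    by (cases u, cases d)
  show ?thesis
  proof (cases "V = {#}")
    case True
    then show ?thesis
      using assms ud by (auto simp: pole_def marked_or_derives_def)
  next
    case False
    \<comment> \<open>A lone \<open>None\<close> is impossible because the multiset contains
      \<open>B\<close>.\<close>
    from assms(1) ud consider A where "W = {#Some A#}" | "2 \<le> size W"
      by (auto simp: pole_def)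
    then show ?thesis
    proof cases
      case 1
      with False ud show ?thesis
        by (simp add: add_Some_in_pole)
    next
      case 2
      with False have "3 \<le> size (W + V)"
        by (cases V) auto
      moreover from this have "W + V \<noteq> {#None, None#}"
        by force
      ultimately show ?thesis
        unfolding ud by (auto simp: pole_def)
    qed
  qed
qed

lemma hyp_atom: "hyp (Prim p) \<in> atom_val x p"
proof (cases "p = x")
  case True
  \<comment> \<open>Both summands carry markers. They add up to the pair of \<open>None\<close> only
    if each is a lone \<open>None\<close> with empty multiset, and then the request is met by the
    axiom.\<close>
  have "a + b + hyp (Prim x) \<in> pole x" if "a \<in> pole x" "b \<in> pole x" for a b
  proof -
    obtain \<Gamma> W \<Delta> V where ab: "a = (\<Gamma>, W)" "b = (\<Delta>, V)"
      by (cases a, cases b)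
    have "W \<noteq> {#}" "V \<noteq> {#}"
      using that ab by (auto simp: pole_def)
    then have "2 \<le> size (W + V)"
      by (metis size_2_cases)
    moreover have "\<Gamma> = {#} \<and> \<Delta> = {#}" if "W + V = {#None, None#}"
    proof -
      have "W = {#None#}" "V = {#None#}"
        using that \<open>W \<noteq> {#}\<close> \<open>V \<noteq> {#}\<close>
        by (cases W; cases V; auto simp: add_eq_conv_ex)+
      then show ?thesis
        using \<open>a \<in> pole x\<close> \<open>b \<in> pole x\<close> ab by (auto simp: pole_def)
    qed
    ultimately show ?thesis
      unfolding ab by (auto simp: pole_def lp_ax)
  qed
  then show ?thesis
    using True by (auto simp: atom_val_def atom_def val_def res_def zero_prod_def set_plus_def)
qed (auto simp: atom_val_def atom_def val_def lp_ax)

lemma atom_val_subset: "atom_val x p \<subseteq> marked_or_derives (Prim p)"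
proof (cases "p = x")
  case True
  \<comment> \<open>Doubling the lone \<open>None\<close> yields the test for
    \<open>Prim x\<close>.\<close>
  have "({#}, {#None#}) + ({#}, {#None#}) \<in> pole x + pole x"
    by (intro set_plus_intro) (auto simp: pole_def)
  then have "({#}, {#None, None#}) + m \<in> pole x" if "m \<in> atom_val x p" for m
    using that True by (auto simp: atom_val_def atom_def val_def res_def)
  then show ?thesis
    using True by (force simp: pole_def marked_or_derives_def)
qed (auto simp: atom_val_def atom_def val_def marked_or_derives_def)

text \<open>Okada's two-sided bound, as in semantic cut elimination. Residuals reverse inclusions,
  so each bound for an implication uses the opposite bound for its argument.\<close>

lemma canonical:
  fixes x :: 'p
  defines "s \<equiv> sem (pole x) (atom_val x)" and "c \<equiv> core (pole x) (atom_val x)"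
  shows "hyp A \<in> s A \<and> c A \<subseteq> marked_or_derives A"
proof -
  have cs: "c A \<subseteq> s A" for A
    unfolding c_def s_def by (intro core_subset_sem zero_notin_atom_val)
  have derives: "s A \<subseteq> marked_or_derives A" if "c A \<subseteq> marked_or_derives A" for A
    using that unfolding c_def s_def by (rule biorth_marked_or_derives)
  have hyp_left: "hyp D \<in> res (s A) (s B)"
    if B: "hyp B \<in> s B" and A: "s A \<subseteq> marked_or_derives A"
      and D: "\<And>\<Gamma> \<Delta> C. lp (add_mset B \<Gamma>) C \<Longrightarrow> lp \<Delta> A \<Longrightarrow> lp (add_mset D (\<Gamma> + \<Delta>)) C"
    for A B D
  proof -
    have "a + hyp D \<in> s B" if "a \<in> s A" for a
    proof -
      have "u + a + hyp D \<in> pole x" if u: "u \<in> res (c B) (pole x)" for u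
      proof (rule pole_left)
        have "u + hyp B \<in> res (c B) (pole x) + s B"
          using u B by (rule set_plus_intro)
        then show "u + hyp B \<in> pole x"
          using res_app unfolding s_def c_def by blast
        show "a \<in> marked_or_derives A"
          using A \<open>a \<in> s A\<close> by blast
      qed (rule D)
      then show ?thesis
        by (auto simp: s_def c_def res_def add.assoc zero_prod_def prod_eq_iff)
    qed
    then show ?thesis
      by (auto simp: res_def zero_prod_def)
  qed
  \<comment> \<open>Adding \<open>hyp A\<close> to an unmarked element gives a derivation of
    \<open>B\<close> with the extra hypothesis \<open>A\<close>; the missing zero in
    \<open>res\<close> supplies the side condition.\<close>
  have right: "res (s A) (s B) \<subseteq> marked_or_derives D"
    if A: "hyp A \<in> s A" and B: "s B \<subseteq> marked_or_derives B"
      and D: "\<And>\<Gamma>. lp (add_mset A \<Gamma>) B \<Longrightarrow> \<Gamma> \<noteq> {#} \<Longrightarrow> lp \<Gamma> D"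
    for A B D
    using A B D by (force simp: res_def marked_or_derives_def zero_prod_def)
  show ?thesis
  proof (induction A)
    case (Prim p)
    then show ?case
      using hyp_atom[of p x] atom_val_subset[of x p] cs[of "Prim p"] by (auto simp: c_def)
  next
    case (Under A B)
    have "c (Under A B) = res (s A) (s B)"
      by (simp add: c_def s_def)
    moreover have "hyp (Under A B) \<in> res (s A) (s B)"
      by (rule hyp_left) (use Under derives in \<open>blast intro: lp_under_left\<close>)+
    moreover have "res (s A) (s B) \<subseteq> marked_or_derives (Under A B)"
      by (rule right) (use Under derives in \<open>blast intro: lp_under_right\<close>)+
    ultimately show ?case
      using cs by blast
  next
    case (Over B A)
    have "c (Over B A) = res (s A) (s B)"
      by (simp add: c_def s_def)
    moreover have "hyp (Over B A) \<in> res (s A) (s B)"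
      by (rule hyp_left) (use Over derives in \<open>blast intro: lp_over_left\<close>)+
    moreover have "res (s A) (s B) \<subseteq> marked_or_derives (Over B A)"
      by (rule right) (use Over derives in \<open>blast intro: lp_over_right\<close>)+
    ultimately show ?case
      using cs by blast
  next
    case (Prod A B)
    have c: "c (Prod A B) = s A + s B"
      by (simp add: c_def s_def)
    have "u + hyp (Prod A B) \<in> pole x" if u: "u \<in> res (c (Prod A B)) (pole x)" for u
    proof (rule pole_prod_left)
      have "hyp A + hyp B \<in> c (Prod A B)"
        unfolding c using Prod by (intro set_plus_intro) auto
      with u have "(hyp A + hyp B) + u \<in> pole x"
        unfolding res_def by blast
      then show "u + hyp A + hyp B \<in> pole x"
        by (simp only: ac_simps)
    qed
    then have "hyp (Prod A B) \<in> s (Prod A B)"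
      by (auto simp: s_def c_def res_def zero_prod_def)
    moreover have "s A + s B \<subseteq> marked_or_derives (Prod A B)"
      using Prod derives[of A] derives[of B]
      by (force simp: set_plus_def marked_or_derives_def intro: lp_prod_right)
    ultimately show ?case
      using c by simp
  qed
qed

section \<open>Completeness and the equivalence of the calculi\<close>

lemma hyps_in_sum_list:
  "(\<And>A. hyp A \<in> s A) \<Longrightarrow> (mset \<Pi>, {#}) \<in> sum_list (map s \<Pi>)"
proof (induction \<Pi>)
  case (Cons A \<Pi>)
  then have "hyp A + (mset \<Pi>, {#}) \<in> s A + sum_list (map s \<Pi>)"
    by (intro set_plus_intro) auto
  then show ?case by simp
qed (simp add: zero_prod_def)

lemma sem_imp_lp:
  assumes "sum_list (map (sem (pole x) (atom_val x)) \<Pi>) \<subseteq> sem (pole x) (atom_val x) A"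
  shows "lp (mset \<Pi>) A"
proof -
  have "(mset \<Pi>, {#}) \<in> sem (pole x) (atom_val x) A"
    by (rule subsetD[OF assms hyps_in_sum_list]) (rule canonical[THEN conjunct1])
  moreover have "sem (pole x) (atom_val x) A \<subseteq> marked_or_derives A"
    by (intro biorth_marked_or_derives canonical[THEN conjunct2])
  ultimately have "(mset \<Pi>, {#}) \<in> marked_or_derives A"
    by blast
  then show ?thesis
    by (simp add: marked_or_derives_def)
qed

text \<open>Soundness followed by completeness in the canonical model eliminates cut. Any primitive
  type may serve as \<open>x\<close>.\<close>

lemma lcs_imp_lp: "lcs \<Pi> A \<Longrightarrow> lp (mset \<Pi>) A"
  by (rule sem_imp_lp[of undefined], rule sem_sound, rule zero_notin_atom_val)

lemma lcyc_imp_lp: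
  assumes "lcyc (map (\<lambda>A. lift x (ant x A)) \<Pi>) (dneg x (suc x A))"
  shows "lp (mset \<Pi>) A"
proof (rule sem_imp_lp[of x])
  have val_x: "val x x = pole x"
    by (simp add: val_def)
  have "den (val x) (lift x (ant x B)) = sem (pole x) (atom_val x) B"
    "den (val x) (dneg x (suc x B)) = sem (pole x) (atom_val x) B" for B
    unfolding den_lift den_dneg den_ant_suc[of "val x" x "atom_val x", OF atom_val_def[symmetric]] val_x
    by (rule refl)+
  then show "sum_list (map (sem (pole x) (atom_val x)) \<Pi>) \<subseteq> sem (pole x) (atom_val x) A"
    using den_sound[of "val x", OF zero_notin_val assms] unfolding map_map o_def by (simp only:)
qed

theorem theorem6:
  "\<exists>(\<A> :: 'p ltype \<Rightarrow> 'p ctype) (\<S> :: 'p ltype \<Rightarrow> 'p ctype).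
     \<forall>\<Pi> A. \<Pi> \<noteq> [] \<longrightarrow> (lcs \<Pi> A \<longleftrightarrow> lcyc (map \<A> \<Pi>) (\<S> A))"
proof -
  \<comment> \<open>An arbitrary primitive type: \<open>atom\<close> takes care of its occurrences
    in the sequent.\<close>
  let ?x = "undefined :: 'p"
  have "lcs \<Pi> A \<longleftrightarrow> lcyc (map (\<lambda>A. lift ?x (ant ?x A)) \<Pi>) (dneg ?x (suc ?x A))"
    for \<Pi> and A :: "'p ltype"
    using lcs_imp_lp[of \<Pi> A] lp_imp_lcs[of "mset \<Pi>" A \<Pi>] lcyc_imp_lp[of ?x \<Pi> A] lp_imp_lcyc[of \<Pi> A ?x]
    by blast
  then show ?thesis
    by (intro exI[of _ "\<lambda>A. lift ?x (ant ?x A)"] exI[of _ "\<lambda>A. dneg ?x (suc ?x A)"]) simp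
qed

end
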